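(* For every integer $n\ge 0$, the number of ballot-admissible Fibonacci ribbons of length $n$ equals the number of peakless Motzkin paths of length $n$.
   Context: Shapes. For $n\ge 1$, the Fibonacci ribbon shape of length $n$ is the skew shape $P/Q$ (English convention, left-justified rows; row $i$ consists of the boxes in positions $q_i+1,\dots,p_i$) with $P=(n,n-1,n-3,n-5,\dots)$ and $Q=(n-2,n-4,\dots)$, where entries decrease to zero rather than becoming negative. It has exactly $n$ columns; the $i$-th column counted from right to left has 1 box if $i$ is odd and 2 boxes if $i$ is even. Ribbons. A Fibonacci ribbon of length $n$ is a filling of this shape with entries in $\{1,2,3\}$ that is semistandard (rows weakly increasing from left to right, columns strictly increasing from top to bottom). Its linear form is the word obtained by reading the columns from right to left, each column from top to bottom. It is ballot-admissible (a Littlewood-Richardson tableau) if in every prefix of its linear form the number of $1$s is at least the number of $2$s, and the number of $2$s is at least the number of $3$s. For $n=0$ there is, by convention, exactly one (empty) ballot-admissible ribbon. Paths. Let $N=(1,1)$, $E=(1,0)$, $S=(1,-1)$. A peakless Motzkin path of length $n$ is a lattice walk on $\mathbb{Z}^2$ with steps in $\{N,E,S\}$ starting at $(0,0)$, ending at $(n,0)$, always staying at $y\ge 0$, and in which an $N$ step is never immediately followed by an $S$ step. For $n=0$ there is exactly one (empty) path. *)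

theory Defs
  imports "HOL-Library.FuncSet" "HOL-Library.Sublist" "HOL-Library.Product_Plus"
begin

text \<open>Boxes are pairs (row, column), both counted from 1, rows from top to bottom and
  columns from left to right.\<close>

definition skew_shape :: "(nat \<Rightarrow> nat) \<Rightarrow> (nat \<Rightarrow> nat) \<Rightarrow> (nat \<times> nat) set" where
  "skew_shape p q = {(i, j). 1 \<le> i \<and> q i + 1 \<le> j \<and> j \<le> p i}"

text \<open>Fillings are extensional functions on the boxes, so that there are no
  distinct representations of the same filling, and exactly one filling of the empty shape.\<close>

definition semistandard_fillings :: "(nat \<times> nat) set \<Rightarrow> nat set \<Rightarrow> (nat \<times> nat \<Rightarrow> nat) set" where
  "semistandard_fillings D A = {T \<in> D \<rightarrow>\<^sub>E A.
     (\<forall>i j j'. (i, j) \<in> D \<and> (i, j') \<in> D \<and> j < j' \<longrightarrow> T (i, j) \<le> T (i, j')) \<and>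
     (\<forall>i i' j. (i, j) \<in> D \<and> (i', j) \<in> D \<and> i < i' \<longrightarrow> T (i, j) < T (i', j))}"

definition column_word :: "(nat \<times> nat) set \<Rightarrow> (nat \<times> nat \<Rightarrow> nat) \<Rightarrow> nat \<Rightarrow> nat list" where
  "column_word D T j = map (\<lambda>i. T (i, j)) (sorted_list_of_set {i. (i, j) \<in> D})"

text \<open>The outer partition is \<open>(n, n - 1, n - 3, n - 5, \<dots>)\<close> and the inner one is
  \<open>(n - 2, n - 4, \<dots>)\<close>; truncated subtraction makes the entries end in zeros.\<close>

definition fib_outer :: "nat \<Rightarrow> nat \<Rightarrow> nat" where
  "fib_outer n i = (if i = 1 then n else n - (2 * i - 3))"

definition fib_inner :: "nat \<Rightarrow> nat \<Rightarrow> nat" where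
  "fib_inner n i = n - 2 * i"

definition fib_shape :: "nat \<Rightarrow> (nat \<times> nat) set" where
  "fib_shape n = skew_shape (fib_outer n) (fib_inner n)"

definition fib_ribbons :: "nat \<Rightarrow> (nat \<times> nat \<Rightarrow> nat) set" where
  "fib_ribbons n = semistandard_fillings (fib_shape n) {1, 2, 3}"

definition linear_form :: "nat \<Rightarrow> (nat \<times> nat \<Rightarrow> nat) \<Rightarrow> nat list" where
  "linear_form n T = concat (map (column_word (fib_shape n) T) (rev [1..<n + 1]))"

definition ballot :: "nat list \<Rightarrow> bool" where
  "ballot w \<longleftrightarrow> (\<forall>u. prefix u w \<longrightarrow>
     count_list u 2 \<le> count_list u 1 \<and> count_list u 3 \<le> count_list u 2)"

definition ballot_fib_ribbons :: "nat \<Rightarrow> (nat \<times> nat \<Rightarrow> nat) set" where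
  "ballot_fib_ribbons n = {T \<in> fib_ribbons n. ballot (linear_form n T)}"

datatype step = N | E | S

fun step_vec :: "step \<Rightarrow> int \<times> int" where
  "step_vec N = (1, 1)"
| "step_vec E = (1, 0)"
| "step_vec S = (1, -1)"

definition walk_end :: "step list \<Rightarrow> int \<times> int" where
  "walk_end w = (\<Sum>s\<leftarrow>w. step_vec s)"

definition motzkin_paths :: "nat \<Rightarrow> step list set" where
  "motzkin_paths n = {w. walk_end w = (int n, 0) \<and> (\<forall>u. prefix u w \<longrightarrow> 0 \<le> snd (walk_end u))}"

definition peakless :: "step list \<Rightarrow> bool" where
  "peakless w \<longleftrightarrow> \<not> (\<exists>k. Suc k < length w \<and> w ! k = N \<and> w ! Suc k = S)"

definition peakless_motzkin_paths :: "nat \<Rightarrow> step list set" where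
  "peakless_motzkin_paths n = {w \<in> motzkin_paths n. peakless w}"

lemma finite_fib_shape: "finite (fib_shape n)"
proof (rule finite_subset)
  show "fib_shape n \<subseteq> {..n + 3} \<times> {..n}"
    by (auto simp: fib_shape_def skew_shape_def fib_outer_def split: if_splits)
qed simp

lemma finite_ballot_fib_ribbons: "finite (ballot_fib_ribbons n)"
proof (rule finite_subset)
  show "ballot_fib_ribbons n \<subseteq> fib_shape n \<rightarrow>\<^sub>E {1, 2, 3}"
    by (auto simp: ballot_fib_ribbons_def fib_ribbons_def semistandard_fillings_def)
qed (intro finite_PiE finite_fib_shape, simp)

lemma fst_walk_end: "fst (walk_end w) = int (length w)"
proof (induction w)
  case (Cons s w)
  then show ?case by (cases s) (simp_all add: walk_end_def)
qed (simp add: walk_end_def)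

lemma length_motzkin_path: "w \<in> motzkin_paths n \<Longrightarrow> length w = n"
  using fst_walk_end[of w] by (simp add: motzkin_paths_def)

lemma finite_peakless_motzkin_paths: "finite (peakless_motzkin_paths n)"
proof (rule finite_subset)
  have "s \<in> {N, E, S}" for s
    by (cases s) simp_all
  then show "peakless_motzkin_paths n \<subseteq> {w. set w \<subseteq> {N, E, S} \<and> length w = n}"
    by (simp add: peakless_motzkin_paths_def length_motzkin_path subset_iff)
qed (simp add: finite_lists_length_eq)

lemma fib_shape_0: "fib_shape 0 = {}"
  by (auto simp: fib_shape_def skew_shape_def fib_outer_def)

lemma ballot_fib_ribbons_0: "card (ballot_fib_ribbons 0) = 1"
proof -
  have "ballot_fib_ribbons 0 = {\<lambda>_. undefined}"
    by (auto simp: ballot_fib_ribbons_def fib_ribbons_def semistandard_fillings_def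
        fib_shape_0 linear_form_def ballot_def)
  then show ?thesis by simp
qed

lemma peakless_motzkin_paths_0: "peakless_motzkin_paths 0 = {[]}"
proof
  show "peakless_motzkin_paths 0 \<subseteq> {[]}"
    using length_motzkin_path[where n = 0] by (auto simp: peakless_motzkin_paths_def)
  show "{[]} \<subseteq> peakless_motzkin_paths 0"
    by (simp add: peakless_motzkin_paths_def peakless_def motzkin_paths_def walk_end_def zero_prod_def)
qed

lemma fib_shape_column:
  assumes "1 \<le> c" "c \<le> n"
  shows "{i. (i, n + 1 - c) \<in> fib_shape n} =
    (if odd c then {(c + 1) div 2} else {c div 2, c div 2 + 1})"
proof -
  have "(i, n + 1 - c) \<in> fib_shape n \<longleftrightarrow> c \<le> 2 * i \<and> 2 * i \<le> c + 2 \<and> 1 \<le> i" for i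
    using assms unfolding fib_shape_def skew_shape_def fib_outer_def fib_inner_def
    by (cases "i = 1") (simp, linarith, simp, linarith)
  moreover have "c \<le> 2 * i \<and> 2 * i \<le> c + 2 \<and> 1 \<le> i \<longleftrightarrow>
      i \<in> (if odd c then {(c + 1) div 2} else {c div 2, c div 2 + 1})" for i
  proof (cases "odd c")
    case True
    then obtain m where "c = 2 * m + 1" by (elim oddE)
    then show ?thesis by auto
  next
    case False
    then obtain m where "c = 2 * m" by (auto elim: evenE)
    then show ?thesis using assms by auto
  qed
  ultimately show ?thesis
    by blast
qed

end

theory Submission
  imports Defs
begin

text \<open>Encode each column of a ribbon by a step: a single box filled with \<open>1\<close>, \<open>2\<close>, \<open>3\<close>
  becomes \<open>N\<close>, \<open>E\<close>, \<open>S\<close>, and so does a double column filled with \<open>12\<close>, \<open>13\<close>, \<open>23\<close>.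
  Columns are read from right to left, so adjacent columns fit together when the top entry of
  the later one is at most the bottom entry of the earlier one, and the only pair of steps that
  this excludes is \<open>N\<close> followed by \<open>S\<close>. Hence ribbons of length \<open>n\<close> are the same thing as
  peakless words of length \<open>n\<close> (\<open>bij_betw_ribbon_of_word\<close>).

  Under this encoding, reading a column moves the point
  \<open>(a, b) = (#1 - #2, #2 - #3)\<close>, and the ballot condition says that it stays in the Weyl chamber
  \<open>a, b \<ge> 0\<close>. The moves of double columns are those of single columns with the roles of \<open>a\<close> and
  \<open>b\<close> exchanged. Exchanging the two coordinates after each column therefore makes the rule of
  motion the same for all columns (\<open>ballot_columns_word\<close>).

  It remains to compare peakless walks in the chamber that start at the origin and end anywhere
  with peakless walks on the half-line from \<open>0\<close> to \<open>0\<close>. Let \<open>G n (a, b)\<close> count the former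
  from a general starting point, and \<open>K n h\<close> the peakless walks on the half-line from height \<open>h\<close>
  to \<open>0\<close>. Then
  \<open>G n (a, b) = (\<Sum>i\<le>a. \<Sum>j\<le>b. K n (i + j))\<close>, which at the origin is the claim. (The
  heights \<open>i + j\<close> are the highest weights that occur when the irreducible
  representation of \<open>SL\<^sub>3\<close> with highest weight \<open>(a, b)\<close> is restricted to \<open>SL\<^sub>2\<close>.)
  Two facts prove the formula. In both models the pair \<open>N S\<close> can always be walked and
  leads back to its starting point, so that avoiding it gives the same second-order recursion in
  \<open>n\<close> (\<open>card_peakless_words_rec\<close>); and summing over one step commutes with the double sum
  (\<open>transfer_box_sum\<close>).\<close>

section \<open>Counting peakless words accepted by a partial automaton\<close>

text \<open>Walks in a region are words accepted by a partial automaton: a step that would leave the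
  region has no transition. This lets walks in the half-line and in the chamber share one
  recursion.\<close>
fun accepted :: "(step \<Rightarrow> 's \<Rightarrow> 's option) \<Rightarrow> 's set \<Rightarrow> 's \<Rightarrow> step list \<Rightarrow> bool" where
  "accepted \<delta> F x [] \<longleftrightarrow> x \<in> F"
| "accepted \<delta> F x (s # w) \<longleftrightarrow> (case \<delta> s x of None \<Rightarrow> False | Some y \<Rightarrow> accepted \<delta> F y w)"

definition peakless_words :: "(step \<Rightarrow> 's \<Rightarrow> 's option) \<Rightarrow> 's set \<Rightarrow> nat \<Rightarrow> 's \<Rightarrow> step list set" where
  "peakless_words \<delta> F n x = {w. length w = n \<and> peakless w \<and> accepted \<delta> F x w}"

definition transfer :: "(step \<Rightarrow> 's \<Rightarrow> 's option) \<Rightarrow> ('s \<Rightarrow> nat) \<Rightarrow> 's \<Rightarrow> nat" where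
  "transfer \<delta> f x = (\<Sum>s\<in>{N, E, S}. case \<delta> s x of None \<Rightarrow> 0 | Some y \<Rightarrow> f y)"

lemma UNIV_step: "(UNIV :: step set) = {N, E, S}"
  using step.exhaust by blast

lemma peakless_Nil: "peakless []"
  by (simp add: peakless_def)

lemma peakless_Cons:
  "peakless (s # w) \<longleftrightarrow> peakless w \<and> \<not> (s = N \<and> (\<exists>v. w = S # v))"
proof -
  have "(\<exists>k. Suc k < length (s # w) \<and> (s # w) ! k = N \<and> (s # w) ! Suc k = S) \<longleftrightarrow>
      (s = N \<and> (\<exists>v. w = S # v)) \<or> (\<exists>k. Suc k < length w \<and> w ! k = N \<and> w ! Suc k = S)"
    (is "(\<exists>k. ?P k) \<longleftrightarrow> _")
  proof -
    have "(\<exists>k. ?P k) \<longleftrightarrow> ?P 0 \<or> (\<exists>k. ?P (Suc k))"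
      by (metis not0_implies_Suc)
    moreover have "?P 0 \<longleftrightarrow> s = N \<and> (\<exists>v. w = S # v)"
      by (cases w) auto
    ultimately show ?thesis by auto
  qed
  then show ?thesis by (auto simp: peakless_def)
qed

lemma finite_peakless_words: "finite (peakless_words \<delta> F n x)"
proof (rule finite_subset)
  show "peakless_words \<delta> F n x \<subseteq> {w. set w \<subseteq> UNIV \<and> length w = n}"
    by (auto simp: peakless_words_def)
  show "finite {w :: step list. set w \<subseteq> UNIV \<and> length w = n}"
    by (rule finite_lists_length_eq) (simp add: UNIV_step)
qed

lemma card_peakless_words_0: "card (peakless_words \<delta> F 0 x) = (if x \<in> F then 1 else 0)"
proof -
  have "peakless_words \<delta> F 0 x = (if x \<in> F then {[]} else {})"
    by (auto simp: peakless_words_def peakless_Nil)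
  then show ?thesis by simp
qed

text \<open>Words of length \<open>n + 1\<close> in which only the part after the first step has to be peakless.\<close>
definition prepended :: "(step \<Rightarrow> 's \<Rightarrow> 's option) \<Rightarrow> 's set \<Rightarrow> nat \<Rightarrow> 's \<Rightarrow> step list set" where
  "prepended \<delta> F n x =
    (\<Union>s\<in>{N, E, S}. case \<delta> s x of None \<Rightarrow> {} | Some y \<Rightarrow> (#) s ` peakless_words \<delta> F n y)"

lemma card_prepended:
  "card (prepended \<delta> F n x) = transfer \<delta> (\<lambda>y. card (peakless_words \<delta> F n y)) x"
proof -
  have "card (prepended \<delta> F n x) =
      (\<Sum>s\<in>{N, E, S}. card (case \<delta> s x of None \<Rightarrow> {} | Some y \<Rightarrow> (#) s ` peakless_words \<delta> F n y))"
    unfolding prepended_def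
    by (rule card_UN_disjoint) (auto simp: finite_peakless_words split: option.splits)
  also have "\<dots> = transfer \<delta> (\<lambda>y. card (peakless_words \<delta> F n y)) x"
    unfolding transfer_def by (rule sum.cong) (auto simp: card_image split: option.splits)
  finally show ?thesis .
qed

lemma mem_prepended:
  "w \<in> prepended \<delta> F n x \<longleftrightarrow>
    (\<exists>s v. w = s # v \<and> length v = n \<and> peakless v \<and> accepted \<delta> F x (s # v))"
proof -
  have "w \<in> prepended \<delta> F n x \<longleftrightarrow>
      (\<exists>s. case \<delta> s x of None \<Rightarrow> False | Some y \<Rightarrow> w \<in> (#) s ` peakless_words \<delta> F n y)"
    unfolding prepended_def UNIV_step[symmetric] by (auto split: option.splits)
  also have "\<dots> \<longleftrightarrow> (\<exists>s v. w = s # v \<and> length v = n \<and> peakless v \<and> accepted \<delta> F x (s # v))"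
    by (rule ex_cong1) (auto simp: peakless_words_def split: option.splits)
  finally show ?thesis .
qed

lemma card_peakless_words_1:
  "card (peakless_words \<delta> F (Suc 0) x) = transfer \<delta> (\<lambda>y. card (peakless_words \<delta> F 0 y)) x"
proof -
  have "peakless_words \<delta> F (Suc 0) x = prepended \<delta> F 0 x"
    by (auto simp: mem_prepended peakless_words_def length_Suc_conv peakless_Cons peakless_Nil)
  then show ?thesis by (simp add: card_prepended)
qed

text \<open>A step in front of a peakless word gives a peakless word, unless it gives \<open>N S v\<close> with \<open>S v\<close>
  peakless. As \<open>N S\<close> returns to the state \<open>x\<close>, and a peakless \<open>v\<close> stays peakless after
  \<open>S\<close>, the exceptions correspond to the peakless words \<open>v\<close> accepted from \<open>x\<close>.\<close>
lemma card_peakless_words_rec: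
  assumes "\<delta> N x = Some y" "\<delta> S y = Some x"
  shows "card (peakless_words \<delta> F (Suc (Suc n)) x) + card (peakless_words \<delta> F n x) =
    transfer \<delta> (\<lambda>y. card (peakless_words \<delta> F (Suc n) y)) x"
proof -
  define P where "P = (\<lambda>v. N # S # v) ` peakless_words \<delta> F n x"
  have P: "w \<in> P \<longleftrightarrow>
      (\<exists>v. w = N # S # v \<and> length v = n \<and> peakless v \<and> accepted \<delta> F x v)" for w
    by (auto simp: P_def peakless_words_def)
  have "w \<in> prepended \<delta> F (Suc n) x \<longleftrightarrow> w \<in> peakless_words \<delta> F (Suc (Suc n)) x \<or> w \<in> P" for w
  proof (cases "\<exists>v. w = N # S # v")
    case True
    then show ?thesis
      using assms by (auto simp: mem_prepended P peakless_words_def peakless_Cons)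
  next
    case False
    then show ?thesis
      unfolding mem_prepended P peakless_words_def
      by (cases w) (auto simp: peakless_Cons)
  qed
  then have "prepended \<delta> F (Suc n) x = peakless_words \<delta> F (Suc (Suc n)) x \<union> P"
    by blast
  moreover have "peakless_words \<delta> F (Suc (Suc n)) x \<inter> P = {}"
    by (auto simp: P_def peakless_words_def peakless_Cons)
  moreover have "card P = card (peakless_words \<delta> F n x)"
    unfolding P_def by (rule card_image) (auto simp: inj_on_def)
  ultimately show ?thesis
    using card_Un_disjoint[of "peakless_words \<delta> F (Suc (Suc n)) x" P]
    by (simp add: card_prepended[symmetric] finite_peakless_words P_def)
qed

section \<open>Walks in the half-line and in the Weyl chamber\<close>

fun height_step :: "step \<Rightarrow> nat \<Rightarrow> nat option" where
  "height_step N h = Some (Suc h)"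
| "height_step E h = Some h"
| "height_step S 0 = None"
| "height_step S (Suc h) = Some h"

text \<open>A single box adds \<open>(1, 0)\<close>, \<open>(-1, 1)\<close> or \<open>(0, -1)\<close> to \<open>(a, b)\<close>. The target is written with its
  coordinates exchanged, which is the form in which the following double column acts by the
  same rule.\<close>
fun chamber_step :: "step \<Rightarrow> nat \<times> nat \<Rightarrow> (nat \<times> nat) option" where
  "chamber_step N (a, b) = Some (b, Suc a)"
| "chamber_step E (0, b) = None"
| "chamber_step E (Suc a, b) = Some (Suc b, a)"
| "chamber_step S (a, 0) = None"
| "chamber_step S (a, Suc b) = Some (b, a)"

definition box_sum :: "(nat \<Rightarrow> nat) \<Rightarrow> nat \<times> nat \<Rightarrow> nat" where
  "box_sum f = (\<lambda>(a, b). \<Sum>i\<le>a. \<Sum>j\<le>b. f (i + j))"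

lemma box_sum_add: "box_sum (\<lambda>h. f h + g h) x = box_sum f x + box_sum g x"
  by (simp add: box_sum_def sum.distrib split: prod.split)

lemma box_sum_swap: "box_sum f (a, b) = box_sum f (b, a)"
  unfolding box_sum_def prod.case
  by (subst sum.swap) (simp add: add.commute)

lemma box_sum_Suc_left: "box_sum f (Suc a, b) = box_sum f (a, b) + (\<Sum>j\<le>b. f (Suc a + j))"
  by (simp add: box_sum_def)

text \<open>The induction on \<open>a\<close> compares the rows that the two sides gain from \<open>a\<close> to \<open>a + 1\<close>. Those
  coming from the moves \<open>E\<close> and \<open>S\<close> do not match separately: one row is an entry too long and the other an
  entry too short, and the entry is \<open>f (a + b + 1)\<close> in both cases.\<close>
lemma transfer_box_sum:
  "transfer chamber_step (box_sum f) (a, b) = box_sum (transfer height_step f) (a, b)"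
proof -
  have chamber: "transfer chamber_step (box_sum f) (a, b) = box_sum f (Suc a, b) +
      (case a of 0 \<Rightarrow> 0 | Suc a' \<Rightarrow> box_sum f (a', Suc b)) +
      (case b of 0 \<Rightarrow> 0 | Suc b' \<Rightarrow> box_sum f (a, b'))" for a b
    by (simp add: transfer_def box_sum_swap split: nat.split)
  have height: "transfer height_step f h =
      f (Suc h) + f h + (case h of 0 \<Rightarrow> 0 | Suc h' \<Rightarrow> f h')" for h
    by (simp add: transfer_def split: nat.split)
  show ?thesis
  proof (induction a)
    case 0
    have "(\<Sum>j\<le>b. case j of 0 \<Rightarrow> 0 | Suc h \<Rightarrow> f h) =
        (case b of 0 \<Rightarrow> 0 | Suc b' \<Rightarrow> box_sum f (0, b'))"
      by (cases b) (simp_all add: box_sum_def sum.atMost_Suc_shift del: sum.atMost_Suc)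
    then show ?case
      unfolding chamber by (simp add: box_sum_def height sum.distrib)
  next
    case (Suc a)
    have "box_sum f (a, Suc b) =
        (case a of 0 \<Rightarrow> 0 | Suc a' \<Rightarrow> box_sum f (a', Suc b)) + (\<Sum>j\<le>Suc b. f (a + j))"
      by (cases a) (simp_all add: box_sum_def)
    moreover
    have "(case b of 0 \<Rightarrow> 0 | Suc b' \<Rightarrow> box_sum f (Suc a, b')) + f (Suc (a + b)) =
        (case b of 0 \<Rightarrow> 0 | Suc b' \<Rightarrow> box_sum f (a, b')) + (\<Sum>j\<le>b. f (Suc (a + j)))"
      by (cases b) (simp_all add: box_sum_def)
    ultimately show ?case
      using Suc unfolding chamber
      by (simp add: box_sum_Suc_left height sum.distrib)
  qed
qed

lemma card_chamber_words_0:
  "card (peakless_words chamber_step UNIV 0 (a, b)) =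
    box_sum (\<lambda>h. card (peakless_words height_step {0} 0 h)) (a, b)"
proof -
  have "(\<Sum>i\<le>a. \<Sum>j\<le>b. if i = 0 \<and> j = 0 then 1 else 0 :: nat) = (\<Sum>i\<le>a. if i = 0 then 1 else 0)"
    by (rule sum.cong) auto
  then show ?thesis
    by (simp add: card_peakless_words_0 box_sum_def)
qed

text \<open>For \<open>n = 1\<close> a word cannot contain \<open>N S\<close>, so the recursion has no correction term there and
  the first-order formula is used.\<close>
lemma card_chamber_words:
  "card (peakless_words chamber_step UNIV n (a, b)) =
    box_sum (\<lambda>h. card (peakless_words height_step {0} n h)) (a, b)"
proof (induction n arbitrary: a b rule: induct_nat_012)
  case 0
  show ?case by (rule card_chamber_words_0)
next
  case 1
  have "(\<lambda>x. card (peakless_words chamber_step UNIV 0 x)) =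
      box_sum (\<lambda>h. card (peakless_words height_step {0} 0 h))"
    by (auto simp: card_chamber_words_0)
  moreover have "(\<lambda>h. card (peakless_words height_step {0} (Suc 0) h)) =
      transfer height_step (\<lambda>h. card (peakless_words height_step {0} 0 h))"
    by (rule ext) (rule card_peakless_words_1)
  ultimately show ?case
    by (simp add: card_peakless_words_1[of chamber_step] transfer_box_sum)
next
  case (ge2 n)
  let ?G = "\<lambda>n x. card (peakless_words chamber_step UNIV n x)"
  let ?K = "\<lambda>n h. card (peakless_words height_step {0} n h)"
  have G: "?G n = box_sum (?K n)" "?G (Suc n) = box_sum (?K (Suc n))"
    using ge2 by auto
  have "?G (Suc (Suc n)) (a, b) + ?G n (a, b) = transfer chamber_step (?G (Suc n)) (a, b)"
    by (rule card_peakless_words_rec) (rule chamber_step.simps, simp)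
  also have "\<dots> = box_sum (transfer height_step (?K (Suc n))) (a, b)"
    by (simp add: G transfer_box_sum)
  also have "transfer height_step (?K (Suc n)) = (\<lambda>h. ?K (Suc (Suc n)) h + ?K n h)"
    by (rule ext, rule card_peakless_words_rec[symmetric]) (rule height_step.simps, simp)
  also have "box_sum \<dots> (a, b) = box_sum (?K (Suc (Suc n))) (a, b) + ?G n (a, b)"
    by (simp add: box_sum_add G(1)[THEN fun_cong])
  finally show ?case
    by simp
qed

section \<open>Motzkin paths\<close>

lemma walk_end_Cons: "walk_end (s # w) = step_vec s + walk_end w"
  by (simp add: walk_end_def)

lemma all_prefix_Cons: "(\<forall>u. prefix u (x # w) \<longrightarrow> P u) \<longleftrightarrow> P [] \<and> (\<forall>u. prefix u w \<longrightarrow> P (x # u))"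
  by (auto simp: prefix_Cons)

lemma accepted_height_step:
  "accepted height_step {0} h w \<longleftrightarrow>
    int h + snd (walk_end w) = 0 \<and> (\<forall>u. prefix u w \<longrightarrow> 0 \<le> int h + snd (walk_end u))"
proof (induction w arbitrary: h)
  case Nil
  then show ?case by (simp add: walk_end_def)
next
  case (Cons s w)
  show ?case
  proof (cases "height_step s h")
    case None
    then have "s = S" "h = 0" by (cases s; cases h; simp)+
    moreover have "prefix [S] (S # w)" by simp
    ultimately show ?thesis
      by (auto simp: walk_end_def all_prefix_Cons intro!: exI[of _ "[]"])
  next
    case (Some k)
    then have k: "int h + snd (step_vec s) = int k" by (cases s; cases h) auto
    then have "int h + snd (walk_end (s # u)) = int k + snd (walk_end u)" for u
      by (simp add: walk_end_Cons)
    then show ?thesis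
      using Some by (simp add: Cons.IH all_prefix_Cons) (simp add: walk_end_def)
  qed
qed

lemma peakless_motzkin_paths_eq: "peakless_motzkin_paths n = peakless_words height_step {0} n 0"
proof -
  have "walk_end w = (int n, 0) \<longleftrightarrow> length w = n \<and> snd (walk_end w) = 0" for w
    by (auto simp: prod_eq_iff fst_walk_end)
  then show ?thesis
    by (auto simp: peakless_motzkin_paths_def motzkin_paths_def peakless_words_def
        accepted_height_step)
qed

section \<open>Columns\<close>

text \<open>The flag tells whether the column has a single box.\<close>
fun column :: "bool \<Rightarrow> step \<Rightarrow> nat list" where
  "column True N = [1]"
| "column True E = [2]"
| "column True S = [3]"
| "column False N = [1, 2]"
| "column False E = [1, 3]"
| "column False S = [2, 3]"

fun columns_word :: "bool \<Rightarrow> step list \<Rightarrow> nat list" where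
  "columns_word p [] = []"
| "columns_word p (s # w) = column p s @ columns_word (\<not> p) w"

lemma columns_word_eq:
  "columns_word p w = concat (map (\<lambda>k. column (even k = p) (w ! k)) [0..<length w])"
proof (induction w arbitrary: p)
  case (Cons s w)
  have "[0..<length (s # w)] = 0 # map Suc [0..<length w]"
    by (simp add: map_Suc_upt upt_conv_Cons del: upt_Suc)
  moreover have "(even (Suc k) = p) \<longleftrightarrow> (even k = (\<not> p))" for k
    by auto
  ultimately show ?case
    by (simp only: columns_word.simps Cons.IH) (simp add: comp_def del: upt_Suc)
qed simp

definition ballot_from :: "nat \<Rightarrow> nat \<Rightarrow> nat list \<Rightarrow> bool" where
  "ballot_from a b w \<longleftrightarrow> (\<forall>u. prefix u w \<longrightarrow>
     count_list u 2 \<le> count_list u 1 + a \<and> count_list u 3 \<le> count_list u 2 + b)"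

lemma ballot_from_Nil: "ballot_from a b []"
  by (simp add: ballot_from_def)

lemma ballot_from_Cons:
  "ballot_from a b (Suc 0 # w) \<longleftrightarrow> ballot_from (Suc a) b w"
  "ballot_from a b (2 # w) \<longleftrightarrow> (case a of 0 \<Rightarrow> False | Suc a' \<Rightarrow> ballot_from a' (Suc b) w)"
  "ballot_from a b (3 # w) \<longleftrightarrow> (case b of 0 \<Rightarrow> False | Suc b' \<Rightarrow> ballot_from a b' w)"
  unfolding ballot_from_def all_prefix_Cons
  by (auto split: nat.split intro: exI[of _ "[]"])

text \<open>For a word that starts with a double column, the coordinates have been exchanged an odd number
  of times, so the automaton is in the state \<open>(b, a)\<close>.\<close>
lemma ballot_columns_word:
  "ballot_from a b (columns_word p w) \<longleftrightarrow>
    accepted chamber_step UNIV (if p then (a, b) else (b, a)) w"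
proof (induction w arbitrary: p a b)
  case (Cons s w)
  show ?case
    by (cases p; cases s; cases a; cases b) (simp_all add: Cons.IH ballot_from_Cons)
qed (simp add: ballot_from_Nil)

section \<open>Fibonacci ribbons as peakless words\<close>

text \<open>Here \<open>c\<close> numbers the columns from right to left. For odd \<open>c\<close> the top and the bottom box
  coincide, and the bottom box of column \<open>c\<close> always lies in the same row as the top box of
  column \<open>c + 1\<close>.\<close>
definition top_box :: "nat \<Rightarrow> nat \<Rightarrow> nat \<times> nat" where
  "top_box n c = ((c + 1) div 2, n + 1 - c)"

definition bottom_box :: "nat \<Rightarrow> nat \<Rightarrow> nat \<times> nat" where
  "bottom_box n c = (c div 2 + 1, n + 1 - c)"

lemma mem_fib_shape_iff:
  "z \<in> fib_shape n \<longleftrightarrow> (\<exists>c\<in>{1..n}. z = top_box n c \<or> z = bottom_box n c)"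
proof
  assume z: "z \<in> fib_shape n"
  obtain i j where ij: "z = (i, j)" by fastforce
  define c where "c = n + 1 - j"
  have j: "1 \<le> j" "j \<le> n"
    using z by (auto simp: ij fib_shape_def skew_shape_def fib_outer_def split: if_splits)
  then have c: "1 \<le> c" "c \<le> n" "j = n + 1 - c"
    by (auto simp: c_def)
  have "i \<in> {i. (i, n + 1 - c) \<in> fib_shape n}"
    using z c(3) ij by simp
  then have "z = top_box n c \<or> z = bottom_box n c"
    unfolding fib_shape_column[OF c(1,2)]
    using c by (auto simp: ij top_box_def bottom_box_def split: if_splits)
  then show "\<exists>c\<in>{1..n}. z = top_box n c \<or> z = bottom_box n c"
    using c by auto
next
  assume "\<exists>c\<in>{1..n}. z = top_box n c \<or> z = bottom_box n c"
  then obtain c where c: "1 \<le> c" "c \<le> n" "z = top_box n c \<or> z = bottom_box n c"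
    by auto
  then have "fst z \<in> {i. (i, n + 1 - c) \<in> fib_shape n}"
    unfolding fib_shape_column[OF c(1,2)] by (auto simp: top_box_def bottom_box_def elim!: oddE)
  then show "z \<in> fib_shape n"
    using c(3) by (auto simp: top_box_def bottom_box_def)
qed

text \<open>Rows have at most three boxes, so comparing neighbours is enough by transitivity: the left and
  right box of a row of three are the top and the bottom of double columns, with a
  single box in between.\<close>
lemma fib_ribbons_iff:
  "T \<in> fib_ribbons n \<longleftrightarrow> T \<in> fib_shape n \<rightarrow>\<^sub>E {1, 2, 3} \<and>
    (\<forall>c. 1 \<le> c \<and> c < n \<longrightarrow> T (top_box n (Suc c)) \<le> T (bottom_box n c)) \<and>
    (\<forall>c. 1 \<le> c \<and> c \<le> n \<and> even c \<longrightarrow> T (top_box n c) < T (bottom_box n c))"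
  (is "_ \<longleftrightarrow> _ \<and> ?row \<and> ?col")
proof -
  let ?row' = "\<forall>i j j'. (i, j) \<in> fib_shape n \<and> (i, j') \<in> fib_shape n \<and> j < j' \<longrightarrow> T (i, j) \<le> T (i, j')"
  let ?col' = "\<forall>i i' j. (i, j) \<in> fib_shape n \<and> (i', j) \<in> fib_shape n \<and> i < i' \<longrightarrow> T (i, j) < T (i', j)"
  have mem: "top_box n c \<in> fib_shape n" "bottom_box n c \<in> fib_shape n" if "1 \<le> c" "c \<le> n" for c
    using that by (auto simp: mem_fib_shape_iff)
  have "?col \<longleftrightarrow> ?col'"
  proof
    assume col: ?col
    show ?col'
    proof (intro allI impI, elim conjE)
      fix i i' j assume "(i, j) \<in> fib_shape n" "(i', j) \<in> fib_shape n" "i < i'"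
      then obtain c c' where c: "c \<in> {1..n}" "(i, j) = top_box n c \<or> (i, j) = bottom_box n c"
          and c': "c' \<in> {1..n}" "(i', j) = top_box n c' \<or> (i', j) = bottom_box n c'"
        unfolding mem_fib_shape_iff by blast
      have "c' = c"
        using c c' by (auto simp: top_box_def bottom_box_def)
      with c c' \<open>i < i'\<close> have "even c" "(i, j) = top_box n c" "(i', j) = bottom_box n c"
        by (auto simp: top_box_def bottom_box_def) presburger+
      then show "T (i, j) < T (i', j)"
        using col c by auto
    qed
  next
    assume col: ?col'
    show ?col
    proof (intro allI impI, elim conjE)
      fix c assume c: "1 \<le> c" "c \<le> n" "even c"
      then show "T (top_box n c) < T (bottom_box n c)"
        using col mem[OF c(1,2)] unfolding top_box_def bottom_box_def
        by auto
    qed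
  qed
  moreover have "?row \<longleftrightarrow> ?row'" if ?col
  proof
    assume row: ?row
    show ?row'
    proof (intro allI impI, elim conjE)
      fix i j j' assume ij: "(i, j) \<in> fib_shape n" "(i, j') \<in> fib_shape n" "j < j'"
      obtain c c' where c: "c \<in> {1..n}" "(i, j) = top_box n c \<or> (i, j) = bottom_box n c"
          and c': "c' \<in> {1..n}" "(i, j') = top_box n c' \<or> (i, j') = bottom_box n c'"
        using ij unfolding mem_fib_shape_iff by blast
      have i: "c \<le> 2 * i" "2 * i \<le> c + 2" "c' \<le> 2 * i" "2 * i \<le> c' + 2"
        using c c' by (auto simp: top_box_def bottom_box_def)
      have "c' < c"
        using c c' ij(3) by (auto simp: top_box_def bottom_box_def)
      with i consider "c = c' + 1" | "c = c' + 2" "c' + 2 = 2 * i"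
        by linarith
      then show "T (i, j) \<le> T (i, j')"
      proof cases
        case 1
        then have "(i, j) = top_box n (Suc c')" "(i, j') = bottom_box n c'"
          using i c c' by (auto simp: top_box_def bottom_box_def)
        then show ?thesis
          using row c c' 1 by simp
      next
        case 2
        then have "(i, j) = top_box n (Suc (Suc c'))" "(i, j') = bottom_box n c'"
            "bottom_box n (Suc c') = top_box n (Suc c')"
          using i c c' by (auto simp: top_box_def bottom_box_def)
        then have "T (i, j) \<le> T (top_box n (Suc c'))" "T (top_box n (Suc c')) \<le> T (i, j')"
          using row[rule_format, of "Suc c'"] row[rule_format, of c'] c c' 2 by simp_all
        then show ?thesis
          by (rule order_trans)
      qed
    qed
  next
    assume row: ?row'
    show ?row
    proof (intro allI impI, elim conjE)
      fix c assume c: "1 \<le> c" "c < n"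
      then show "T (top_box n (Suc c)) \<le> T (bottom_box n c)"
        using row mem(1)[of "Suc c"] mem(2)[of c] unfolding top_box_def bottom_box_def
        by auto
    qed
  qed
  moreover have "T \<in> fib_ribbons n \<longleftrightarrow> T \<in> fib_shape n \<rightarrow>\<^sub>E {1, 2, 3} \<and> ?row' \<and> ?col'"
    by (simp only: fib_ribbons_def semistandard_fillings_def mem_Collect_eq)
  ultimately show ?thesis
    by argo
qed

definition ribbon_of_word :: "nat \<Rightarrow> step list \<Rightarrow> nat \<times> nat \<Rightarrow> nat" where
  "ribbon_of_word n w = (\<lambda>(i, j)\<in>fib_shape n.
    let c = n + 1 - j; col = column (odd c) (w ! (c - 1))
    in if i = (c + 1) div 2 then hd col else last col)"

lemma ribbon_of_word_box:
  assumes "1 \<le> c" "c \<le> n"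
  shows "ribbon_of_word n w (top_box n c) = hd (column (odd c) (w ! (c - 1)))"
    and "ribbon_of_word n w (bottom_box n c) = last (column (odd c) (w ! (c - 1)))"
proof -
  have mem: "top_box n c \<in> fib_shape n" "bottom_box n c \<in> fib_shape n"
    using assms by (auto simp: mem_fib_shape_iff)
  have c: "n + 1 - (n + 1 - c) = c"
    using assms by simp
  have val: "ribbon_of_word n w (i, n + 1 - c) =
      (if i = (c + 1) div 2 then hd (column (odd c) (w ! (c - 1))) else last (column (odd c) (w ! (c - 1))))"
    if "(i, n + 1 - c) \<in> fib_shape n" for i
    using that by (simp only: ribbon_of_word_def restrict_def if_True prod.case Let_def c)
  have odd: "hd (column True s) = last (column True s)" for s
    by (cases s) auto
  have even: "c div 2 + 1 \<noteq> (c + 1) div 2" if "even c"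
    using that by auto
  show "ribbon_of_word n w (top_box n c) = hd (column (odd c) (w ! (c - 1)))"
    using mem(1) unfolding top_box_def by (simp only: val refl if_True)
  show "ribbon_of_word n w (bottom_box n c) = last (column (odd c) (w ! (c - 1)))"
    using mem(2) even odd unfolding bottom_box_def
    by (cases "odd c") (simp_all only: val if_False split: if_split, simp_all)
qed

text \<open>The last statement is the reason why ribbons correspond to peakless words: a single column
  followed by a double one is excluded only for \<open>1\<close> and \<open>23\<close>, and a double column followed
  by a single one only for \<open>12\<close> and \<open>3\<close>.\<close>
lemma column_hd_last:
  "hd (column p s) \<in> {1, 2, 3}" "last (column p s) \<in> {1, 2, 3}"
  "hd (column p s) = hd (column p t) \<Longrightarrow> last (column p s) = last (column p t) \<Longrightarrow> s = t"
  "hd (column False s) < last (column False s)"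
  "hd (column (\<not> p) t) \<le> last (column p s) \<longleftrightarrow> \<not> (s = N \<and> t = S)"
  by (cases p; cases s; cases t; simp)+

lemma column_hd_last_surj:
  assumes "x \<in> {1, 2, 3}" "y \<in> {1, 2, 3}" "if p then x = y else x < y"
  shows "\<exists>s. hd (column p s) = x \<and> last (column p s) = y"
proof -
  have "\<exists>s\<in>{N, E, S}. hd (column p s) = x \<and> last (column p s) = y"
    using assms by (cases p) auto
  then show ?thesis by blast
qed

text \<open>A column is determined by its top and bottom entries. These can be any entries with the right
  relation inside the column, and the row condition between neighbouring columns is
  the absence of \<open>N S\<close>.\<close>
lemma bij_betw_ribbon_of_word:
  "bij_betw (ribbon_of_word n) {w. length w = n \<and> peakless w} (fib_ribbons n)"
proof (intro bij_betw_imageI equalityI subsetI inj_onI)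
  fix w w' assume w: "w \<in> {w. length w = n \<and> peakless w}" and w': "w' \<in> {w. length w = n \<and> peakless w}"
    and eq: "ribbon_of_word n w = ribbon_of_word n w'"
  have "w ! k = w' ! k" if "k < n" for k
    using ribbon_of_word_box[of "Suc k" n w] ribbon_of_word_box[of "Suc k" n w'] that
    unfolding eq by (intro column_hd_last(3)[of "odd (Suc k)"]) simp_all
  then show "w = w'"
    using w w' by (auto intro: nth_equalityI)
next
  fix T assume "T \<in> ribbon_of_word n ` {w. length w = n \<and> peakless w}"
  then obtain w where w: "length w = n" "peakless w" "T = ribbon_of_word n w"
    by auto
  have "T z \<in> {1, 2, 3}" if "z \<in> fib_shape n" for z
    using that ribbon_of_word_box[of _ n w] column_hd_last(1,2)
    unfolding mem_fib_shape_iff w(3) by (metis atLeastAtMost_iff)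
  moreover have "T z = undefined" if "z \<notin> fib_shape n" for z
    using that by (simp add: w(3) ribbon_of_word_def)
  moreover have "T (top_box n (Suc c)) \<le> T (bottom_box n c)" if "1 \<le> c" "c < n" for c
  proof -
    have "\<not> (w ! (c - 1) = N \<and> w ! c = S)"
      using w(1,2) that unfolding peakless_def by (metis Suc_pred' less_eq_Suc_le One_nat_def)
    then show ?thesis
      using that column_hd_last(5)[of "odd c" "w ! c" "w ! (c - 1)"]
      by (simp add: w(3) ribbon_of_word_box)
  qed
  moreover have "T (top_box n c) < T (bottom_box n c)" if "1 \<le> c" "c \<le> n" "even c" for c
    using that by (simp add: w(3) ribbon_of_word_box column_hd_last(4))
  ultimately show "T \<in> fib_ribbons n"
    unfolding fib_ribbons_iff by (intro conjI PiE_I) auto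
next
  fix T assume T: "T \<in> fib_ribbons n"
  have mem: "T (top_box n c) \<in> {1, 2, 3}" "T (bottom_box n c) \<in> {1, 2, 3}" if "1 \<le> c" "c \<le> n" for c
  proof -
    have "top_box n c \<in> fib_shape n" "bottom_box n c \<in> fib_shape n"
      using that by (auto simp: mem_fib_shape_iff)
    then show "T (top_box n c) \<in> {1, 2, 3}" "T (bottom_box n c) \<in> {1, 2, 3}"
      using T PiE_mem unfolding fib_ribbons_iff by fast+
  qed
  have "\<exists>s. hd (column (odd c) s) = T (top_box n c) \<and> last (column (odd c) s) = T (bottom_box n c)"
    if "1 \<le> c" "c \<le> n" for c
  proof (rule column_hd_last_surj[OF mem[OF that]])
    have "top_box n c = bottom_box n c" if "odd c"
      using that by (auto simp: top_box_def bottom_box_def elim!: oddE)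
    then show "if odd c then T (top_box n c) = T (bottom_box n c) else T (top_box n c) < T (bottom_box n c)"
      using T that unfolding fib_ribbons_iff by auto
  qed
  then obtain s where s: "hd (column (odd c) (s c)) = T (top_box n c)"
      "last (column (odd c) (s c)) = T (bottom_box n c)" if "1 \<le> c" "c \<le> n" for c
    by metis
  define w where "w = map (\<lambda>k. s (Suc k)) [0..<n]"
  have w: "w ! (c - 1) = s c" if "1 \<le> c" "c \<le> n" for c
    using that by (cases c) (simp_all add: w_def)
  have "peakless w"
    unfolding peakless_def
  proof (intro notI, elim exE conjE)
    fix k assume k: "Suc k < length w" "w ! k = N" "w ! Suc k = S"
    then have "T (top_box n (Suc (Suc k))) \<le> T (bottom_box n (Suc k))"
      using T unfolding fib_ribbons_iff by (simp add: w_def)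
    then show False
      using k s[of "Suc k"] s[of "Suc (Suc k)"] column_hd_last(5)[of "odd (Suc k)" S N]
      by (simp add: w_def)
  qed
  moreover have "ribbon_of_word n w = T"
  proof
    fix z
    show "ribbon_of_word n w z = T z"
    proof (cases "z \<in> fib_shape n")
      case True
      then show ?thesis
        unfolding mem_fib_shape_iff using s w by (auto simp: ribbon_of_word_box)
    next
      case False
      then show ?thesis
        using T unfolding fib_ribbons_iff by (auto simp: ribbon_of_word_def)
    qed
  qed
  moreover have "length w = n"
    by (simp add: w_def)
  ultimately show "T \<in> ribbon_of_word n ` {w. length w = n \<and> peakless w}"
    by blast
qed

lemma linear_form_ribbon_of_word:
  assumes "length w = n"
  shows "linear_form n (ribbon_of_word n w) = columns_word True w"
proof -
  have col: "column_word (fib_shape n) (ribbon_of_word n w) (n + 1 - c) = column (odd c) (w ! (c - 1))"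
    if c: "1 \<le> c" "c \<le> n" for c
  proof (cases "odd c")
    case True
    have "column True s = [hd (column True s)]" for s by (cases s) auto
    then show ?thesis
      using True ribbon_of_word_box(1)[OF c, of w]
      by (simp add: column_word_def fib_shape_column[OF c, simplified] top_box_def)
  next
    case False
    have "sorted_list_of_set {k, k + 1} = [k, k + 1]" for k :: nat
      by simp
    moreover have "column False s = [hd (column False s), last (column False s)]" for s
      by (cases s) auto
    moreover have "(c + 1) div 2 = c div 2"
      using False by auto
    ultimately show ?thesis
      using False ribbon_of_word_box[OF c, of w]
      by (simp add: column_word_def fib_shape_column[OF c] top_box_def bottom_box_def del: One_nat_def)
  qed
  have rev: "rev [1..<n + 1] = map (\<lambda>k. n + 1 - Suc k) [0..<n]"
    by (rule nth_equalityI) (auto simp: rev_nth simp del: upt_Suc)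
  have "map (column_word (fib_shape n) (ribbon_of_word n w)) (rev [1..<n + 1]) =
      map (\<lambda>k. column (even k = True) (w ! k)) [0..<n]"
    unfolding rev map_map comp_def
    by (rule map_cong[OF refl]) (subst col; simp)
  then show ?thesis
    by (simp only: linear_form_def columns_word_eq assms)
qed

lemma bij_betw_ballot_fib_ribbons:
  "bij_betw (ribbon_of_word n) (peakless_words chamber_step UNIV n (0, 0)) (ballot_fib_ribbons n)"
proof -
  have "ballot (linear_form n (ribbon_of_word n w)) \<longleftrightarrow> accepted chamber_step UNIV (0, 0) w"
    if "length w = n" for w
  proof -
    have "ballot v \<longleftrightarrow> ballot_from 0 0 v" for v
      by (simp add: ballot_def ballot_from_def)
    then show ?thesis
      using ballot_columns_word[of 0 0 True w] that by (simp add: linear_form_ribbon_of_word)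
  qed
  then have "peakless_words chamber_step UNIV n (0, 0) =
      {w \<in> {w. length w = n \<and> peakless w}. ballot (linear_form n (ribbon_of_word n w))}"
    by (auto simp: peakless_words_def)
  then show ?thesis
    using bij_betw_ribbon_of_word[of n]
    unfolding bij_betw_def inj_on_def ballot_fib_ribbons_def by auto
qed

theorem corollary3p3p7:
  fixes n :: nat
  shows "card (ballot_fib_ribbons n) = card (peakless_motzkin_paths n)"
  using bij_betw_same_card[OF bij_betw_ballot_fib_ribbons[of n]]
  by (simp add: card_chamber_words box_sum_def peakless_motzkin_paths_eq)

end
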